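(* In the power-beacon assisted multi-source network described in the context, with energy states $\vec s_1,\dots,\vec s_N$, $N=(1+L)^K$, and one-step state transition matrix $\mathbf A\in\mathbb R^{N\times N}$, the energy outage probability is $$P_{EO}=\sum_{n:\ \vec s_n\in\Theta_1}\pi_n ,$$ where $\pi_n$ is the $n$-th component of the vector $$\boldsymbol\pi=\left(\mathbf A^{T}-\mathbf E+\mathbf Q\right)^{-1}\mathbf b ,$$ with $\mathbf E$ the $N\times N$ identity matrix, $\mathbf Q$ the $N\times N$ all-ones matrix and $\mathbf b=(1,1,\dots,1)^T\in\mathbb R^N$.
   Context: Network. There are a power beacon $B$ with $N_B\ge 2$ antennas and transmit power $P_B>0$, $K\ge 1$ single-antenna half-duplex sources $S_1,\dots,S_K$, and a single-antenna destination $D$. Time is divided into slots of length $T_0>0$. In each slot the channel coefficients $h_{B_bS_k}$, $h_{B_bD}$ (from antenna $b$ of $B$), $h_{S_kD}$, $h_{S_iS_k}$ are mutually independent circularly symmetric complex Gaussian variables, with $\mathbb E|h_{B_bS_k}|^2=\bar\gamma_{BS_k}$ (for all $b$), $\mathbb E|h_{B_bD}|^2=\bar\gamma_{BD}$, $\mathbb E|h_{S_kD}|^2=\bar\gamma_{S_kD}$, $\mathbb E|h_{S_iS_k}|^2=\bar\gamma_{S_iS_k}$, all positive constants; they are independent from slot to slot. Write $\mathbf h_{BS_k}=[h_{B_1S_k},\dots,h_{B_{N_B}S_k}]^T$, $\mathbf h_{BD}=[h_{B_1D},\dots,h_{B_{N_B}D}]^T$. Energy levels. Each source has an energy storage of capacity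 $\varepsilon_T>0$, discretized into levels $0,1,\dots,L$ ($L\ge1$), level $l$ meaning stored energy $\varepsilon_l=l\,\varepsilon_\Delta$, $\varepsilon_\Delta=\varepsilon_T/L$. The energy states are the $N=(1+L)^K$ vectors $\vec s_n=[l_1^n,\dots,l_K^n]\in\{0,\dots,L\}^K$. A transmission uses $l_S$ energy levels, $1\le l_S\le L$ fixed, with transmit power $P_S=l_S\varepsilon_\Delta/T_0$. Let $\vartheta_n^{TH}=\{k: l_k^n\ge l_S\}$ be the set of (indices of) sources with sufficient energy in state $\vec s_n$, and $\Theta_1=\{\vec s_n:\vartheta_n^{TH}=\emptyset\}$ (non-information-transmission states), $\Theta_2=\{\vec s_n:\vartheta_n^{TH}\neq\emptyset\}$ (information-transmission states). $\eta>0$ is the energy conversion efficiency. Dynamics in one slot, starting from $\vec s_n$. (i) If $\vec s_n\in\Theta_1$, no source transmits and every source $k$ harvests $\varepsilon_k^n=\eta T_0P_B|\mathbf h_{BS_k}^T\mathbf w_1|^2$, where $\mathbf w_1$ has all entries $1/\sqrt{N_B}$; its new level is $\min\{L,\ l_k^n+\lfloor \varepsilon_k^n/\varepsilon_\Delta\rfloor\}$. (ii) If $\vec s_n\in\Theta_2$, the source with index $i^*=\arg\max_{k\in\vartheta_n^{TH}}|h_{S_kD}|^2$ transmits and its level decreases by $l_S$ (it does not harvest). Every other source $k\ne i^*$ harvests $\varepsilon_k^{n,i^*}=\eta T_0\left(P_S|h_{S_{i^*}S_k}|^2+P_B|\mathbf h_{BS_k}^T\mathbf w_2|^2\right)$,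 where $\mathbf w_2$ is a unit-norm vector, a function of $\mathbf h_{BD}$ only, with $\mathbf h_{BD}^T\mathbf w_2=0$; its new level is $\min\{L,\ l_k^n+\lfloor\varepsilon_k^{n,i^*}/\varepsilon_\Delta\rfloor\}$. The energy state thus evolves as a time-homogeneous Markov chain; $\mathbf A=(a_{n,n'})$, where $a_{n,n'}$ is the one-step probability of moving from $\vec s_n$ to $\vec s_{n'}$. Energy outage probability. A source is in energy outage when it does not have enough energy to transmit (level below $l_S$); the network is in energy outage when all its sources are simultaneously in energy outage. The energy outage probability $P_{EO}$ is the probability, in the stationary regime (unique stationary distribution) of the Markov chain of energy states, that the network is in energy outage. *)

theory Defs
  imports "HOL-Probability.Probability"
begin

text \<open>
  The antennas of the beacon are indexed by a finite type \<open>'b\<close> (so \<open>N_B = CARD('b)\<close>) and the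
  sources by a finite type \<open>'k\<close> (so \<open>K = CARD('k) \<ge> 1\<close>).  The links are beacon antenna to source,
  beacon antenna to destination, source to destination, and (directed) source to source.
\<close>

datatype ('b, 'k) link = BS 'b 'k | BD 'b | SD 'k | SS 'k 'k

text \<open>There is no channel from a source to itself.\<close>

definition links :: "('b, 'k) link set" where
  "links = {l. \<forall>k. l \<noteq> SS k k}"

record ('b::finite, 'k) network =
  beacon_power :: real
  slot_length :: real
  capacity :: real
  max_level :: nat
  tx_levels :: nat
  efficiency :: real
  gain_BS :: "'k \<Rightarrow> real"
  gain_BD :: real
  gain_SD :: "'k \<Rightarrow> real"
  gain_SS :: "'k \<Rightarrow> 'k \<Rightarrow> real"
  w2 :: "complex ^ 'b \<Rightarrow> complex ^ 'b"

text \<open>The bilinear product \<open>v\<^sup>T w\<close>, without conjugation.\<close>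

definition tdot :: "complex ^ 'b::finite \<Rightarrow> complex ^ 'b \<Rightarrow> complex" where
  "tdot v w = (\<Sum>b\<in>UNIV. v $ b * w $ b)"

definition w1 :: "complex ^ 'b::finite" where
  "w1 = (\<chi> b. complex_of_real (1 / sqrt (real CARD('b))))"

text \<open>
  Admissible parameters.  The second beamformer is a (Borel) function of the beacon-to-destination
  channel vector alone.
\<close>

definition valid_network :: "('b::finite, 'k::finite) network \<Rightarrow> bool" where
  "valid_network net \<longleftrightarrow>
     beacon_power net > 0 \<and> slot_length net > 0 \<and> capacity net > 0 \<and> efficiency net > 0 \<and>
     max_level net \<ge> 1 \<and> 1 \<le> tx_levels net \<and> tx_levels net \<le> max_level net \<and>
     (\<forall>k. gain_BS net k > 0) \<and> gain_BD net > 0 \<and> (\<forall>k. gain_SD net k > 0) \<and>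
     (\<forall>i k. i \<noteq> k \<longrightarrow> gain_SS net i k > 0) \<and>
     w2 net \<in> borel_measurable borel \<and>
     (\<forall>v. norm (w2 net v) = 1 \<and> tdot v (w2 net v) = 0)"

fun gain :: "('b::finite, 'k) network \<Rightarrow> ('b, 'k) link \<Rightarrow> real" where
  "gain net (BS b k) = gain_BS net k"
| "gain net (BD b) = gain_BD net"
| "gain net (SD k) = gain_SD net k"
| "gain net (SS i k) = gain_SS net i k"

text \<open>
  Circularly symmetric complex Gaussian \<open>X\<close> with \<open>E |X|\<^sup>2 = g\<close>: independent centred normal real and
  imaginary parts, each of variance \<open>g / 2\<close> (\<^const>\<open>normal_density\<close> takes the standard deviation).
\<close>

definition cscg :: "'w measure \<Rightarrow> ('w \<Rightarrow> complex) \<Rightarrow> real \<Rightarrow> bool" where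
  "cscg M X g \<longleftrightarrow>
     distributed M lborel (\<lambda>\<omega>. Re (X \<omega>)) (\<lambda>x. ennreal (normal_density 0 (sqrt (g / 2)) x)) \<and>
     distributed M lborel (\<lambda>\<omega>. Im (X \<omega>)) (\<lambda>x. ennreal (normal_density 0 (sqrt (g / 2)) x)) \<and>
     prob_space.indep_var M borel (\<lambda>\<omega>. Re (X \<omega>)) borel (\<lambda>\<omega>. Im (X \<omega>))"

text \<open>\<open>h t l\<close> is the coefficient of link \<open>l\<close> in slot \<open>t\<close>.\<close>

definition channel_model ::
  "'w measure \<Rightarrow> ('b::finite, 'k::finite) network \<Rightarrow> (nat \<Rightarrow> ('b, 'k) link \<Rightarrow> 'w \<Rightarrow> complex) \<Rightarrow> bool"
where
  "channel_model M net h \<longleftrightarrow>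
     (\<forall>t. \<forall>l\<in>links. cscg M (h t l) (gain net l)) \<and>
     prob_space.indep_vars M (\<lambda>_. borel) (\<lambda>(t, l). h t l) (UNIV \<times> links)"

text \<open>An energy state assigns to each source its energy level.\<close>

type_synonym 'k energy_state = "'k \<Rightarrow> nat"

definition energy_states :: "('b::finite, 'k) network \<Rightarrow> 'k energy_state set" where
  "energy_states net = {s. \<forall>k. s k \<le> max_level net}"

lemma card_energy_states:
  fixes net :: "('b::finite, 'k::finite) network"
  shows "card (energy_states net) = (1 + max_level net) ^ CARD('k)"
proof -
  have "energy_states net = (UNIV :: 'k set) \<rightarrow>\<^sub>E {..max_level net}"
    by (auto simp: energy_states_def PiE_def Pi_def)
  then show ?thesis
    by (simp add: card_PiE)
qed

definition eps_delta :: "('b::finite, 'k) network \<Rightarrow> real" where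
  "eps_delta net = capacity net / real (max_level net)"

definition source_power :: "('b::finite, 'k) network \<Rightarrow> real" where
  "source_power net = real (tx_levels net) * eps_delta net / slot_length net"

definition able :: "('b::finite, 'k) network \<Rightarrow> 'k energy_state \<Rightarrow> 'k set" where
  "able net s = {k. tx_levels net \<le> s k}"

definition Theta1 :: "('b::finite, 'k) network \<Rightarrow> 'k energy_state set" where
  "Theta1 net = {s \<in> energy_states net. able net s = {}}"

definition charge :: "('b::finite, 'k) network \<Rightarrow> nat \<Rightarrow> real \<Rightarrow> nat" where
  "charge net l e = min (max_level net) (l + nat \<lfloor>e / eps_delta net\<rfloor>)"

text \<open>In the following, \<open>c\<close> is the realization of all channel coefficients in one slot.\<close>

definition vec_BS :: "(('b::finite, 'k) link \<Rightarrow> complex) \<Rightarrow> 'k \<Rightarrow> complex ^ 'b" where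
  "vec_BS c k = (\<chi> b. c (BS b k))"

definition vec_BD :: "(('b::finite, 'k) link \<Rightarrow> complex) \<Rightarrow> complex ^ 'b" where
  "vec_BD c = (\<chi> b. c (BD b))"

definition harvest1 :: "('b::finite, 'k) network \<Rightarrow> (('b, 'k) link \<Rightarrow> complex) \<Rightarrow> 'k \<Rightarrow> real" where
  "harvest1 net c k =
     efficiency net * slot_length net * beacon_power net * (cmod (tdot (vec_BS c k) w1))\<^sup>2"

definition harvest2 ::
  "('b::finite, 'k) network \<Rightarrow> (('b, 'k) link \<Rightarrow> complex) \<Rightarrow> 'k \<Rightarrow> 'k \<Rightarrow> real" where
  "harvest2 net c i k =
     efficiency net * slot_length net *
       (source_power net * (cmod (c (SS i k)))\<^sup>2 +
        beacon_power net * (cmod (tdot (vec_BS c k) (w2 net (vec_BD c))))\<^sup>2)"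

text \<open>Ties in the maximum have probability zero.\<close>

definition transmitter ::
  "('b::finite, 'k) network \<Rightarrow> (('b, 'k) link \<Rightarrow> complex) \<Rightarrow> 'k energy_state \<Rightarrow> 'k" where
  "transmitter net c s = arg_max_on (\<lambda>k. (cmod (c (SD k)))\<^sup>2) (able net s)"

definition next_state ::
  "('b::finite, 'k) network \<Rightarrow> (('b, 'k) link \<Rightarrow> complex) \<Rightarrow> 'k energy_state \<Rightarrow> 'k energy_state"
where
  "next_state net c s =
     (if able net s = {} then (\<lambda>k. charge net (s k) (harvest1 net c k))
      else (\<lambda>k. if k = transmitter net c s then s k - tx_levels net
                else charge net (s k) (harvest2 net c (transmitter net c s) k)))"

text \<open>The energy state at the beginning of slot \<open>t\<close>, starting from \<open>s\<close> in slot \<open>0\<close>.\<close>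

primrec energy_process ::
  "('b::finite, 'k) network \<Rightarrow> (nat \<Rightarrow> ('b, 'k) link \<Rightarrow> 'w \<Rightarrow> complex) \<Rightarrow>
   'k energy_state \<Rightarrow> nat \<Rightarrow> 'w \<Rightarrow> 'k energy_state"
where
  "energy_process net h s 0 \<omega> = s"
| "energy_process net h s (Suc t) \<omega> =
     next_state net (\<lambda>l. h t l \<omega>) (energy_process net h s t \<omega>)"

text \<open>
  As the coefficients are i.i.d. over the slots, the chain is time-homogeneous, and its one-step
  transition probabilities are those of the first step.
\<close>

definition trans_prob ::
  "'w measure \<Rightarrow> ('b::finite, 'k) network \<Rightarrow> (nat \<Rightarrow> ('b, 'k) link \<Rightarrow> 'w \<Rightarrow> complex) \<Rightarrow>
   'k energy_state \<Rightarrow> 'k energy_state \<Rightarrow> real"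
where
  "trans_prob M net h s s' = measure M {\<omega> \<in> space M. energy_process net h s 1 \<omega> = s'}"

text \<open>Here \<open>st\<close> is the enumeration of the energy states.\<close>

definition transition_matrix ::
  "'w measure \<Rightarrow> ('b::finite, 'k) network \<Rightarrow> (nat \<Rightarrow> ('b, 'k) link \<Rightarrow> 'w \<Rightarrow> complex) \<Rightarrow>
   ('n::finite \<Rightarrow> 'k energy_state) \<Rightarrow> real ^ 'n ^ 'n"
where
  "transition_matrix M net h st = (\<chi> n n'. trans_prob M net h (st n) (st n'))"

definition stationary_distribution ::
  "'w measure \<Rightarrow> ('b::finite, 'k) network \<Rightarrow> (nat \<Rightarrow> ('b, 'k) link \<Rightarrow> 'w \<Rightarrow> complex) \<Rightarrow>
   'k energy_state pmf \<Rightarrow> bool"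
where
  "stationary_distribution M net h p \<longleftrightarrow>
     set_pmf p \<subseteq> energy_states net \<and>
     (\<forall>s'\<in>energy_states net.
        pmf p s' = (\<Sum>s\<in>energy_states net. pmf p s * trans_prob M net h s s'))"

definition source_outage :: "('b::finite, 'k) network \<Rightarrow> 'k energy_state \<Rightarrow> 'k \<Rightarrow> bool" where
  "source_outage net s k \<longleftrightarrow> s k < tx_levels net"

definition network_outage :: "('b::finite, 'k) network \<Rightarrow> 'k energy_state \<Rightarrow> bool" where
  "network_outage net s \<longleftrightarrow> (\<forall>k. source_outage net s k)"

definition energy_outage_prob ::
  "'w measure \<Rightarrow> ('b::finite, 'k) network \<Rightarrow> (nat \<Rightarrow> ('b, 'k) link \<Rightarrow> 'w \<Rightarrow> complex) \<Rightarrow> real"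
where
  "energy_outage_prob M net h =
     measure_pmf.prob (THE p. stationary_distribution M net h p) {s. network_outage net s}"

definition ones_matrix :: "real ^ 'n::finite ^ 'n" where
  "ones_matrix = (\<chi> i j. 1)"

definition ones_vector :: "real ^ 'n::finite" where
  "ones_vector = (\<chi> i. 1)"

end

theory Submission
  imports Defs
begin

text \<open>
  Every energy state leads, with positive probability, to one fixed state.  Suppose that in some
  slot the channels from the beacon to the sources, between the sources, and from one chosen source
  to the destination are strong, and those from the other sources to the destination are weak.  If
  the chosen source has sufficient energy, it transmits and all other storages become full; if no
  source has, all storages become full.  The signal of the transmitting source alone suffices to
  fill the others, so nothing about the second beamformer but its measurability matters.

  For a stochastic matrix \<open>A\<close> with such a root, \<open>A\<^sup>T v = v\<close> implies \<open>A\<^sup>T |v| = |v|\<close>, hence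
  \<open>|v| + v\<close> and \<open>|v| - v\<close> are invariant as well; one of them vanishes at the root and thus everywhere.
  So invariant vectors have constant sign.  As the rows of \<open>A\<close> sum to one, \<open>(A\<^sup>T - E + Q) x = b\<close>
  forces \<open>x\<close> to have sum one and to be invariant, and \<open>(A\<^sup>T - E + Q) x = 0\<close> forces \<open>x\<close> to be
  invariant with sum zero, that is, \<open>x = 0\<close>.
\<close>

subsection \<open>Stochastic matrices with a root\<close>

text \<open>In Markov chain terms: a finite chain with a state accessible from every state, hence
  with exactly one recurrent class. The chain may be periodic.\<close>

locale rooted_stochastic =
  fixes A :: "'n::finite \<Rightarrow> 'n \<Rightarrow> real" and root :: 'n
  assumes nonneg: "0 \<le> A i j"
    and row_sum: "(\<Sum>j\<in>UNIV. A i j) = 1"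
    and root_reachable: "(i, root) \<in> {(i, j). 0 < A i j}\<^sup>*"
begin

definition invariant :: "('n \<Rightarrow> real) \<Rightarrow> bool" where
  "invariant v \<longleftrightarrow> (\<forall>j. v j = (\<Sum>i\<in>UNIV. v i * A i j))"

lemma invariantI: "(\<And>j. v j = (\<Sum>i\<in>UNIV. v i * A i j)) \<Longrightarrow> invariant v"
  unfolding invariant_def by blast

lemma invariantD: "invariant v \<Longrightarrow> (\<Sum>i\<in>UNIV. v i * A i j) = v j"
  unfolding invariant_def by (rule sym) blast

text \<open>The triangle inequality gives one inequality in each entry. As the rows of
  \<open>A\<close> sum to one, both sides have the same total, so no entry can be strict.\<close>

lemma invariant_abs:
  assumes "invariant v"
  shows "invariant (\<lambda>i. \<bar>v i\<bar>)"
proof -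
  have le: "\<bar>v j\<bar> \<le> (\<Sum>i\<in>UNIV. \<bar>v i\<bar> * A i j)" for j
  proof -
    have "\<bar>v j\<bar> = \<bar>\<Sum>i\<in>UNIV. v i * A i j\<bar>"
      by (simp only: invariantD[OF assms])
    also have "\<dots> \<le> (\<Sum>i\<in>UNIV. \<bar>v i * A i j\<bar>)"
      by (rule sum_abs)
    finally show ?thesis
      by (simp add: abs_mult nonneg)
  qed
  have "(\<Sum>j\<in>UNIV. \<Sum>i\<in>UNIV. \<bar>v i\<bar> * A i j) = (\<Sum>i\<in>UNIV. \<bar>v i\<bar> * (\<Sum>j\<in>UNIV. A i j))"
    unfolding sum_distrib_left by (rule sum.swap)
  then have "(\<Sum>j\<in>UNIV. \<bar>v j\<bar>) = (\<Sum>j\<in>UNIV. \<Sum>i\<in>UNIV. \<bar>v i\<bar> * A i j)"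
    by (simp add: row_sum)
  then have "\<bar>v j\<bar> = (\<Sum>i\<in>UNIV. \<bar>v i\<bar> * A i j)" for j
    by (rule sum_mono_inv) (simp_all add: le)
  then show ?thesis
    by (rule invariantI)
qed

text \<open>If \<open>w j = 0\<close>, invariance writes zero as a sum of nonnegative terms, so
  \<open>w\<close> vanishes at every predecessor of \<open>j\<close>. The zero at
  \<open>root\<close> thus spreads backwards along the paths to it.\<close>

lemma invariant_nonneg_zero:
  assumes "invariant w" and w: "\<And>i. 0 \<le> w i" and "w root = 0"
  shows "w i = 0"
  using root_reachable[of i]
proof (induction rule: converse_rtrancl_induct)
  case base
  show ?case by fact
next
  case (step i j)
  have "(\<Sum>k\<in>UNIV. w k * A k j) = 0"
    using invariantD[OF assms(1)] step.IH by simp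
  then have "w i * A i j = 0"
    using w nonneg by (subst (asm) sum_nonneg_eq_0_iff) auto
  then show ?case
    using step.hyps by auto
qed

text \<open>These are twice the positive and twice the negative part of \<open>v\<close>.\<close>

lemma invariant_add_sub_abs:
  assumes "invariant v"
  shows "invariant (\<lambda>i. \<bar>v i\<bar> + v i)" and "invariant (\<lambda>i. \<bar>v i\<bar> - v i)"
  by (auto intro!: invariantI simp: distrib_right left_diff_distrib sum.distrib sum_subtractf
      invariantD[OF assms] invariantD[OF invariant_abs[OF assms]])

text \<open>The sign at \<open>root\<close> decides which of the two parts vanishes there, and hence
  everywhere. A negative value at \<open>root\<close> would make the total negative.\<close>

lemma invariant_nonneg:
  assumes v: "invariant v" and sum: "0 \<le> (\<Sum>i\<in>UNIV. v i)"
  shows "0 \<le> v i"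
proof (cases "0 \<le> v root")
  case True
  have "\<bar>v i\<bar> - v i = 0"
    by (rule invariant_nonneg_zero[OF invariant_add_sub_abs(2)[OF v]]) (use True in auto)
  then show ?thesis by simp
next
  case False
  have "\<bar>v j\<bar> + v j = 0" for j
    by (rule invariant_nonneg_zero[OF invariant_add_sub_abs(1)[OF v]]) (use False in auto)
  then have "v j \<le> 0" for j
    using abs_ge_zero[of "v j"] by (smt (verit))
  then have "(\<Sum>i\<in>UNIV. v i) < (\<Sum>i\<in>(UNIV::'n set). 0)"
    using False by (intro sum_strict_mono_ex1) (auto simp: not_le)
  with sum show ?thesis by simp
qed

lemma invariant_sum_zero:
  assumes "invariant v" and sum: "(\<Sum>i\<in>UNIV. v i) = 0"
  shows "v i = 0"
  using invariant_nonneg[OF assms(1)] sum by (simp add: sum_nonneg_eq_0_iff)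

section \<open>The linear system for the invariant distribution\<close>

abbreviation balance_matrix :: "real ^ 'n ^ 'n" where
  "balance_matrix \<equiv> transpose (\<chi> i j. A i j) - mat 1 + ones_matrix"

lemma balance_matrix_mult:
  "(balance_matrix *v x) $ j = (\<Sum>i\<in>UNIV. x $ i * A i j) - x $ j + (\<Sum>i\<in>UNIV. x $ i)"
  by (simp add: matrix_vector_mult_add_rdistrib matrix_vector_mult_diff_rdistrib
      del: transpose_matrix_vector)
    (simp add: matrix_vector_mult_def transpose_def ones_matrix_def mult.commute
      del: transpose_matrix_vector)

text \<open>Unit row sums cancel the first two terms in total, so only the all-ones matrix
  contributes. This is how the system encodes the normalization.\<close>

lemma sum_balance_matrix_mult:
  "(\<Sum>j\<in>UNIV. (balance_matrix *v x) $ j) = real CARD('n) * (\<Sum>i\<in>UNIV. x $ i)"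
proof -
  have "(\<Sum>j\<in>UNIV. \<Sum>i\<in>UNIV. x $ i * A i j) = (\<Sum>i\<in>UNIV. x $ i * (\<Sum>j\<in>UNIV. A i j))"
    unfolding sum_distrib_left by (rule sum.swap)
  then show ?thesis
    unfolding balance_matrix_mult by (simp add: sum.distrib sum_subtractf row_sum)
qed

lemma invertible_balance_matrix: "invertible balance_matrix"
proof -
  have "x = 0" if x: "balance_matrix *v x = 0" for x
  proof -
    have sum: "(\<Sum>i\<in>UNIV. x $ i) = 0"
      using sum_balance_matrix_mult[of x] unfolding x by simp
    have "invariant (($) x)"
    proof (rule invariantI)
      fix j
      have "(balance_matrix *v x) $ j = 0"
        unfolding x by simp
      then show "x $ j = (\<Sum>i\<in>UNIV. x $ i * A i j)"
        unfolding balance_matrix_mult sum by simp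
    qed
    then have "x $ i = 0" for i
      using sum by (rule invariant_sum_zero)
    then show ?thesis
      by (simp add: vec_eq_iff)
  qed
  then show ?thesis
    unfolding invertible_left_inverse matrix_left_invertible_ker by blast
qed

text \<open>Adding up all equations forces total one; the all-ones matrix then contributes exactly
  the right-hand side, and what remains of each equation is invariance.\<close>

lemma balance_matrix_eq_ones_iff:
  "balance_matrix *v x = ones_vector \<longleftrightarrow> invariant (($) x) \<and> (\<Sum>i\<in>UNIV. x $ i) = 1"
proof
  assume x: "balance_matrix *v x = ones_vector"
  have sum: "(\<Sum>i\<in>UNIV. x $ i) = 1"
    using sum_balance_matrix_mult[of x] unfolding x by (simp add: ones_vector_def)
  have "(balance_matrix *v x) $ j = 1" for j
    unfolding x by (simp add: ones_vector_def)
  then have "x $ j = (\<Sum>i\<in>UNIV. x $ i * A i j)" for j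
    unfolding balance_matrix_mult sum by simp
  then have "invariant (($) x)"
    by (rule invariantI)
  with sum show "invariant (($) x) \<and> (\<Sum>i\<in>UNIV. x $ i) = 1"
    by simp
next
  assume "invariant (($) x) \<and> (\<Sum>i\<in>UNIV. x $ i) = 1"
  then have "(balance_matrix *v x) $ j = 1" for j
    by (simp add: balance_matrix_mult invariantD)
  then show "balance_matrix *v x = ones_vector"
    by (simp add: vec_eq_iff ones_vector_def)
qed

lemma matrix_inv_balance_eq_iff:
  "x = matrix_inv balance_matrix *v ones_vector \<longleftrightarrow>
     invariant (($) x) \<and> (\<Sum>i\<in>UNIV. x $ i) = 1"
proof -
  \<comment> \<open>\<open>matrix_inv\<close> is a Hilbert choice, so its two defining identities
    hold only once invertibility is known.\<close>
  have inv: "balance_matrix ** matrix_inv balance_matrix = mat 1 \<and>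
      matrix_inv balance_matrix ** balance_matrix = mat 1"
    using invertible_balance_matrix unfolding invertible_def matrix_inv_def by (rule someI_ex)
  have "x = matrix_inv balance_matrix *v ones_vector \<longleftrightarrow> balance_matrix *v x = ones_vector"
  proof
    assume x: "x = matrix_inv balance_matrix *v ones_vector"
    show "balance_matrix *v x = ones_vector"
      unfolding x matrix_vector_mul_assoc inv[THEN conjunct1] by simp
  next
    assume x: "balance_matrix *v x = ones_vector"
    show "x = matrix_inv balance_matrix *v ones_vector"
      unfolding x[symmetric] matrix_vector_mul_assoc inv[THEN conjunct2] by simp
  qed
  then show ?thesis
    by (simp add: balance_matrix_eq_ones_iff)
qed

end

subsection \<open>Channels and measurability\<close>

lemma finite_links: "finite (A :: ('b::finite, 'k::finite) link set)"
proof -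
  have "(UNIV :: ('b, 'k) link set) \<subseteq>
      range (\<lambda>(b, k). BS b k) \<union> range BD \<union> range SD \<union> range (\<lambda>(i, k). SS i k)"
  proof
    fix l :: "('b, 'k) link"
    show "l \<in> range (\<lambda>(b, k). BS b k) \<union> range BD \<union> range SD \<union> range (\<lambda>(i, k). SS i k)"
      by (cases l) auto
  qed
  then have "finite (UNIV :: ('b, 'k) link set)"
    by (rule finite_subset) simp
  then show ?thesis
    by (rule rev_finite_subset) simp
qed

lemma borel_measurable_vec_lambda:
  fixes f :: "'i::finite \<Rightarrow> 'w \<Rightarrow> 'c::euclidean_space"
  assumes [measurable]: "\<And>i. f i \<in> borel_measurable M"
  shows "(\<lambda>x. \<chi> i. f i x) \<in> borel_measurable M"
proof (subst borel_measurable_euclidean_space, rule ballI)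
  fix b :: "'c ^ 'i"
  assume "b \<in> Basis"
  then obtain i u where "b = axis i u"
    by (auto simp: Basis_vec_def)
  then show "(\<lambda>x. (\<chi> i. f i x) \<bullet> b) \<in> borel_measurable M"
    by (simp add: inner_axis)
qed

text \<open>The density is positive everywhere, so probability zero would make the interval a
  Lebesgue null set.\<close>

lemma (in prob_space) normal_prob_interval_pos:
  assumes X: "distributed M lborel X (\<lambda>x. ennreal (normal_density \<mu> \<sigma> x))"
    and "0 < \<sigma>" and "a < b"
  shows "0 < prob (X -` {a..b} \<inter> space M)"
proof -
  have "emeasure M (X -` {a..b} \<inter> space M) \<noteq> 0"
  proof
    assume "emeasure M (X -` {a..b} \<inter> space M) = 0"
    then have "(\<integral>\<^sup>+x. ennreal (normal_density \<mu> \<sigma> x) * indicator {a..b} x \<partial>lborel) = 0"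
      by (subst (asm) distributed_emeasure[OF X]) auto
    then have "AE x in lborel. ennreal (normal_density \<mu> \<sigma> x) * indicator {a..b} x = 0"
      by (subst (asm) nn_integral_0_iff_AE) auto
    then have "AE x in lborel. x \<notin> {a..b}"
    proof eventually_elim
      case (elim x)
      then show ?case
        using normal_density_pos[OF \<open>0 < \<sigma>\<close>, of \<mu> x] by (simp add: indicator_def split: if_splits)
    qed
    then have "emeasure lborel {a..b} = 0"
      by (subst (asm) AE_iff_measurable[where N="{a..b}"]) auto
    with \<open>a < b\<close> show False by simp
  qed
  then show ?thesis
    by (simp add: emeasure_eq_measure zero_less_measure_iff)
qed

text \<open>Rectangles are used because independence of real and imaginary part factorizes their
  probability.\<close>

lemma (in prob_space) cscg_prob_box_pos:
  assumes X: "cscg M X g" and "0 < g" and "a < b" and "c < d"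
  shows "0 < prob (X -` {z. Re z \<in> {a..b} \<and> Im z \<in> {c..d}} \<inter> space M)"
proof -
  have "prob ((\<lambda>x. (Re (X x), Im (X x))) -` ({a..b} \<times> {c..d}) \<inter> space M) =
      prob ((\<lambda>x. Re (X x)) -` {a..b} \<inter> space M) * prob ((\<lambda>x. Im (X x)) -` {c..d} \<inter> space M)"
    using X by (intro indep_varD[where Ma=borel and Mb=borel]) (auto simp: cscg_def)
  also have "\<dots> > 0"
    using assms by (intro mult_pos_pos normal_prob_interval_pos[where \<mu>=0 and \<sigma>="sqrt (g / 2)"])
      (auto simp: cscg_def)
  also have "(\<lambda>x. (Re (X x), Im (X x))) -` ({a..b} \<times> {c..d}) =
      X -` {z. Re z \<in> {a..b} \<and> Im z \<in> {c..d}}"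
    by auto
  finally show ?thesis .
qed

lemma BS_in_links [simp]: "BS b k \<in> links"
  and BD_in_links [simp]: "BD b \<in> links"
  and SD_in_links [simp]: "SD k \<in> links"
  and SS_in_links_iff [simp]: "SS i k \<in> links \<longleftrightarrow> i \<noteq> k"
  by (auto simp: links_def)

lemma borel_measurable_tdot:
  assumes [measurable]: "f \<in> borel_measurable M" "g \<in> borel_measurable M"
  shows "(\<lambda>x. tdot (f x) (g x)) \<in> borel_measurable M"
proof -
  have [measurable]: "(\<lambda>v :: complex ^ 'b. v $ b) \<in> borel_measurable borel" for b
    by (intro borel_measurable_continuous_onI continuous_intros)
  show ?thesis
    unfolding tdot_def by measurable
qed

section \<open>Measurability of the one-slot dynamics\<close>

locale powered_network = prob_space M
  for M :: "'w measure" +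
  fixes net :: "('b::finite, 'k::finite) network"
    and h :: "nat \<Rightarrow> ('b, 'k) link \<Rightarrow> 'w \<Rightarrow> complex"
  assumes valid: "valid_network net"
    and channels: "channel_model M net h"
begin

text \<open>Slot \<open>0\<close>, because \<open>trans_prob\<close> is defined by the first step of
  the process.\<close>

abbreviation channel :: "'w \<Rightarrow> ('b, 'k) link \<Rightarrow> complex" where
  "channel \<omega> \<equiv> \<lambda>l. h 0 l \<omega>"

lemma measurable_channel: "l \<in> links \<Longrightarrow> h t l \<in> borel_measurable M"
  using channels by (force simp: channel_model_def indep_vars_def)

lemmas measurable_links [measurable] =
  measurable_channel[OF BS_in_links] measurable_channel[OF BD_in_links]
  measurable_channel[OF SD_in_links]

lemma measurable_harvest1 [measurable]: "(\<lambda>\<omega>. harvest1 net (channel \<omega>) k) \<in> borel_measurable M"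
proof -
  have "(\<lambda>\<omega>. vec_BS (channel \<omega>) k) \<in> borel_measurable M"
    unfolding vec_BS_def by (intro borel_measurable_vec_lambda) measurable
  note [measurable] = borel_measurable_tdot[OF this borel_measurable_const]
  show ?thesis
    unfolding harvest1_def by measurable
qed

text \<open>The channel model says nothing about \<open>SS k k\<close>, hence the restriction to
  distinct sources.\<close>

lemma measurable_harvest2:
  assumes "i \<noteq> k"
  shows "(\<lambda>\<omega>. harvest2 net (channel \<omega>) i k) \<in> borel_measurable M"
proof -
  have [measurable]: "h 0 (SS i k) \<in> borel_measurable M"
    using assms by (intro measurable_channel) simp
  have [measurable]: "w2 net \<in> borel_measurable borel"
    using valid by (simp add: valid_network_def)
  have [measurable]: "(\<lambda>\<omega>. vec_BS (channel \<omega>) k) \<in> borel_measurable M"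
    unfolding vec_BS_def by (intro borel_measurable_vec_lambda) measurable
  have [measurable]: "(\<lambda>\<omega>. vec_BD (channel \<omega>) :: complex ^ 'b) \<in> borel_measurable M"
    unfolding vec_BD_def by (intro borel_measurable_vec_lambda) measurable
  have [measurable]:
    "(\<lambda>\<omega>. tdot (vec_BS (channel \<omega>) k) (w2 net (vec_BD (channel \<omega>)))) \<in> borel_measurable M"
    by (intro borel_measurable_tdot) measurable
  show ?thesis
    unfolding harvest2_def by measurable
qed

lemma pred_charge:
  assumes [measurable]: "f \<in> borel_measurable M"
  shows "Measurable.pred M (\<lambda>\<omega>. charge net l (f \<omega>) = n)"
  unfolding charge_def by measurable

text \<open>The arg max is a Hilbert choice, also under ties, but its value depends only on the set
  of maximizers. There are finitely many such sets, and each occurs on a measurable event.\<close>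

lemma pred_transmitter: "Measurable.pred M (\<lambda>\<omega>. transmitter net (channel \<omega>) s = i)"
proof -
  define best where "best \<omega> = is_arg_max (\<lambda>k. (cmod (channel \<omega> (SD k)))\<^sup>2) (\<lambda>k. k \<in> able net s)"
    for \<omega>
  have [measurable]: "Measurable.pred M (\<lambda>\<omega>. best \<omega> k)" for k
    unfolding best_def is_arg_max_def by measurable
  have "transmitter net (channel \<omega>) s = (SOME k. best \<omega> k)" for \<omega>
    unfolding transmitter_def arg_max_on_def arg_max_def best_def ..
  moreover have "(SOME k. best \<omega> k) = i \<longleftrightarrow>
      (\<exists>T\<in>{T. (SOME k. k \<in> T) = i}. \<forall>k\<in>UNIV. best \<omega> k \<longleftrightarrow> k \<in> T)" for \<omega>
  proof
    assume "(SOME k. best \<omega> k) = i"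
    then show "\<exists>T\<in>{T. (SOME k. k \<in> T) = i}. \<forall>k\<in>UNIV. best \<omega> k \<longleftrightarrow> k \<in> T"
      by (intro bexI[of _ "{k. best \<omega> k}"]) auto
  next
    assume "\<exists>T\<in>{T. (SOME k. k \<in> T) = i}. \<forall>k\<in>UNIV. best \<omega> k \<longleftrightarrow> k \<in> T"
    then obtain T where "(SOME k. k \<in> T) = i" "best \<omega> = (\<lambda>k. k \<in> T)"
      by auto
    then show "(SOME k. best \<omega> k) = i" by simp
  qed
  ultimately show ?thesis
    by simp
qed

lemma pred_next_state: "Measurable.pred M (\<lambda>\<omega>. next_state net (channel \<omega>) s = s')"
proof (cases "able net s = {}")
  case True
  have "Measurable.pred M (\<lambda>\<omega>. \<forall>k\<in>UNIV. charge net (s k) (harvest1 net (channel \<omega>) k) = s' k)"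
    by (intro pred_intros_finite pred_charge) measurable
  then show ?thesis
    unfolding next_state_def fun_eq_iff using True by simp
next
  case False
  \<comment> \<open>Splitting by the value \<open>i\<close> of the transmitter leaves harvests with
    a fixed transmitter and a receiver different from it, whose measurability is known.\<close>
  have "next_state net (channel \<omega>) s = s' \<longleftrightarrow>
      (\<exists>i\<in>UNIV. transmitter net (channel \<omega>) s = i \<and>
        s i - tx_levels net = s' i \<and>
        (\<forall>k\<in>- {i}. charge net (s k) (harvest2 net (channel \<omega>) i k) = s' k))" for \<omega>
    unfolding next_state_def fun_eq_iff using False by auto
  moreover have "Measurable.pred M (\<lambda>\<omega>. \<exists>i\<in>UNIV. transmitter net (channel \<omega>) s = i \<and>
        s i - tx_levels net = s' i \<and>
        (\<forall>k\<in>- {i}. charge net (s k) (harvest2 net (channel \<omega>) i k) = s' k))"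
    by (intro pred_intros_finite pred_intros_logic pred_charge pred_transmitter
        measurable_harvest2) auto
  ultimately show ?thesis
    by simp
qed

lemma trans_prob_eq: "trans_prob M net h s s' = prob {\<omega> \<in> space M. next_state net (channel \<omega>) s = s'}"
  by (simp add: trans_prob_def)

lemma finite_energy_states: "finite (energy_states net)"
  using card_energy_states[of net] by (intro card_ge_0_finite) simp

lemma next_state_energy_states:
  assumes "s \<in> energy_states net"
  shows "next_state net c s \<in> energy_states net"
  using assms by (auto simp: energy_states_def next_state_def charge_def intro: le_trans[OF diff_le_self])

lemma sum_trans_prob:
  assumes "s \<in> energy_states net"
  shows "(\<Sum>s'\<in>energy_states net. trans_prob M net h s s') = 1"
proof -
  have "(\<Sum>s'\<in>energy_states net. trans_prob M net h s s') =
      prob (\<Union>s'\<in>energy_states net. {\<omega> \<in> space M. next_state net (channel \<omega>) s = s'})"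
    unfolding trans_prob_eq using pred_next_state finite_energy_states
    by (intro finite_measure_finite_Union[symmetric])
      (auto simp: disjoint_family_on_def pred_def)
  also have "(\<Union>s'\<in>energy_states net. {\<omega> \<in> space M. next_state net (channel \<omega>) s = s'}) = space M"
    using next_state_energy_states[OF assms] by auto
  finally show ?thesis
    by (simp add: prob_space)
qed

subsection \<open>Favourable slots and reachability\<close>

text \<open>The summand 2 makes a strong channel beat a weak one. The quotients make the beacon
  signal alone, or the signal of the transmitting source alone, fill a storage.\<close>

definition threshold :: real where
  "threshold = 2 + capacity net / (efficiency net * slot_length net * beacon_power net) +
     capacity net / (efficiency net * slot_length net * source_power net)"

text \<open>The weak box bounds the squared modulus by 2. Strength is asked of the real part, not
  just of the modulus, so that the antenna signals cannot cancel under \<open>w1\<close>.\<close>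

definition favourable :: "'k \<Rightarrow> ('b, 'k) link \<Rightarrow> complex set" where
  "favourable i l =
     (if \<exists>k. k \<noteq> i \<and> l = SD k then {z. Re z \<in> {-1..1} \<and> Im z \<in> {-1..1}}
      else {z. Re z \<in> {threshold..threshold + 1} \<and> Im z \<in> {0..1}})"

text \<open>Joint independence, applied to the finite index set of all links in slot
  \<open>0\<close>, turns the probability into a product of positive box probabilities.\<close>

lemma prob_favourable_pos:
  "0 < prob {\<omega> \<in> space M. \<forall>l\<in>links. h 0 l \<omega> \<in> favourable i l}"
proof -
  have gain: "0 < gain net l" if "l \<in> links" for l
    using that valid by (cases l) (auto simp: valid_network_def)
  have pos: "0 < prob (h 0 l -` favourable i l \<inter> space M)" if "l \<in> links" for l
  proof -
    have X: "cscg M (h 0 l) (gain net l)"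
      using channels that by (simp add: channel_model_def)
    show ?thesis
      unfolding favourable_def
      using cscg_prob_box_pos[OF X gain[OF that], of "-1" 1 "-1" 1]
        cscg_prob_box_pos[OF X gain[OF that], of threshold "threshold + 1" 0 1] by simp
  qed
  have nonempty: "(links :: ('b, 'k) link set) \<noteq> {}"
    by (metis SD_in_links empty_iff)
  let ?X = "\<lambda>(t, l). h t l" and ?B = "\<lambda>(t :: nat, l). favourable i l"
  have "0 < (\<Prod>p\<in>{0} \<times> links. prob (?X p -` ?B p \<inter> space M))"
    using pos by (intro prod_pos) auto
  also have "\<dots> = prob (\<Inter>p\<in>{0} \<times> links. ?X p -` ?B p \<inter> space M)"
  proof (rule indep_varsD[symmetric])
    show "indep_vars (\<lambda>_. borel) ?X (UNIV \<times> links)"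
      using channels by (simp add: channel_model_def)
    show "{0 :: nat} \<times> (links :: ('b, 'k) link set) \<noteq> {}"
      using nonempty by simp
    show "finite ({0 :: nat} \<times> (links :: ('b, 'k) link set))"
      by (simp add: finite_links)
    have "{z. Re z \<in> {a..b} \<and> Im z \<in> {c..d}} \<in> sets borel" for a b c d
      by measurable
    then have "favourable i l \<in> sets borel" for l
      unfolding favourable_def by presburger
    then show "?B p \<in> sets borel" for p
      by (cases p) simp
  qed auto
  also have "(\<Inter>p\<in>{0} \<times> links. ?X p -` ?B p \<inter> space M) =
      {\<omega> \<in> space M. \<forall>l\<in>links. h 0 l \<omega> \<in> favourable i l}"
    using nonempty by auto
  finally show ?thesis .
qed


text \<open>The result of a favourable slot in which \<open>i\<close> transmits: of
  \<open>s\<close>, only the level of \<open>i\<close> is remembered.\<close>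

definition discharge :: "'k \<Rightarrow> 'k energy_state \<Rightarrow> 'k energy_state" where
  "discharge i s = (\<lambda>k. if k = i then s i - tx_levels net else max_level net)"

lemma charge_full:
  assumes "capacity net \<le> e"
  shows "charge net l e = max_level net"
proof -
  have "0 < capacity net" "0 < max_level net"
    using valid by (simp_all add: valid_network_def)
  then have "real (max_level net) \<le> e / eps_delta net"
    using assms by (simp add: eps_delta_def field_simps)
  then have "int (max_level net) \<le> \<lfloor>e / eps_delta net\<rfloor>"
    by (simp add: le_floor_iff)
  then show ?thesis
    by (simp add: charge_def)
qed

lemma
  shows threshold_ge_2: "2 \<le> threshold"
    and capacity_le_beacon:
      "capacity net \<le> efficiency net * slot_length net * (beacon_power net * threshold\<^sup>2)"
    and capacity_le_source:
      "capacity net \<le> efficiency net * slot_length net * (source_power net * threshold\<^sup>2)"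
proof -
  define p where "p = efficiency net * slot_length net * beacon_power net"
  define q where "q = efficiency net * slot_length net * source_power net"
  have pos: "0 < capacity net" "0 < p" "0 < q"
    using valid by (auto simp: valid_network_def p_def q_def source_power_def eps_delta_def)
  have threshold: "threshold = 2 + capacity net / p + capacity net / q"
    by (simp add: threshold_def p_def q_def)
  show ge_2: "2 \<le> threshold"
    using pos by (simp add: threshold)
  \<comment> \<open>The harvests are quadratic in the amplitude; above 1 the square dominates, so
    the linear bounds built into \<open>threshold\<close> suffice.\<close>
  then have "threshold \<le> threshold\<^sup>2"
    by (simp add: power2_eq_square)
  moreover have "capacity net / p \<le> threshold" "capacity net / q \<le> threshold"
    using pos by (simp_all add: threshold)
  ultimately have "capacity net / p \<le> threshold\<^sup>2" "capacity net / q \<le> threshold\<^sup>2"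
    by linarith+
  then have "capacity net \<le> p * threshold\<^sup>2" "capacity net \<le> q * threshold\<^sup>2"
    using pos by (simp_all add: field_simps)
  then show
    "capacity net \<le> efficiency net * slot_length net * (beacon_power net * threshold\<^sup>2)"
    "capacity net \<le> efficiency net * slot_length net * (source_power net * threshold\<^sup>2)"
    by (simp_all add: p_def q_def mult.assoc)
qed

lemma threshold_le_cmod:
  assumes "threshold \<le> Re z"
  shows "threshold\<^sup>2 \<le> (cmod z)\<^sup>2"
  using assms threshold_ge_2 complex_Re_le_cmod[of z] by (intro power_mono) auto

text \<open>The antenna signals add up coherently: the real part of the received amplitude is at
  least \<open>sqrt (real CARD('b))\<close> times \<open>threshold\<close>.\<close>

lemma next_state_favourable_full:
  assumes c: "\<And>l. l \<in> links \<Longrightarrow> c l \<in> favourable i l" and "able net s = {}"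
  shows "next_state net c s = (\<lambda>_. max_level net)"
proof -
  have "charge net (s k) (harvest1 net c k) = max_level net" for k
  proof (rule charge_full)
    have "threshold * 1 \<le> threshold * sqrt (real CARD('b))"
      using threshold_ge_2 by (intro mult_left_mono) (auto simp: Suc_le_eq)
    also have "\<dots> = (\<Sum>b\<in>(UNIV :: 'b set). threshold / sqrt (real CARD('b)))"
      by (simp add: field_simps real_div_sqrt)
    also have "\<dots> \<le> (\<Sum>b\<in>(UNIV :: 'b set). Re (c (BS b k)) / sqrt (real CARD('b)))"
      using c[OF BS_in_links] by (intro sum_mono divide_right_mono) (auto simp: favourable_def)
    also have "\<dots> = Re (tdot (vec_BS c k) w1)"
      by (simp add: tdot_def vec_BS_def w1_def)
    finally have "threshold\<^sup>2 \<le> (cmod (tdot (vec_BS c k) w1))\<^sup>2"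
      by (intro threshold_le_cmod) simp
    then have "efficiency net * slot_length net * (beacon_power net * threshold\<^sup>2) \<le> harvest1 net c k"
      using valid unfolding harvest1_def mult.assoc
      by (intro mult_left_mono) (auto simp: valid_network_def)
    with capacity_le_beacon show "capacity net \<le> harvest1 net c k"
      by simp
  qed
  then show "next_state net c s = (\<lambda>_. max_level net)"
    using \<open>able net s = {}\<close> by (simp add: next_state_def)
qed

lemma next_state_favourable_discharge:
  assumes c: "\<And>l. l \<in> links \<Longrightarrow> c l \<in> favourable i l" and i: "i \<in> able net s"
  shows "next_state net c s = discharge i s"
proof -
  have "(cmod (c (SD k)))\<^sup>2 < (cmod (c (SD i)))\<^sup>2" if "k \<noteq> i" for k
  proof -
    have "\<bar>Re (c (SD k))\<bar> \<le> 1" "\<bar>Im (c (SD k))\<bar> \<le> 1"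
      using c[OF SD_in_links, of k] that by (auto simp: favourable_def)
    then have "(Re (c (SD k)))\<^sup>2 \<le> 1" "(Im (c (SD k)))\<^sup>2 \<le> 1"
      by (simp_all add: abs_square_le_1)
    then have "(cmod (c (SD k)))\<^sup>2 \<le> 2"
      by (simp add: cmod_power2)
    \<comment> \<open>A weak channel reaches at most 2, a strong one at least 4; the strict gap
      rules out ties.\<close>
    also have "(2::real) < 2\<^sup>2"
      by simp
    also have "\<dots> \<le> threshold\<^sup>2"
      using threshold_ge_2 by (intro power_mono) auto
    also have "\<dots> \<le> (cmod (c (SD i)))\<^sup>2"
      using c[OF SD_in_links, of i] by (intro threshold_le_cmod) (auto simp: favourable_def)
    finally show ?thesis .
  qed
  then have transmitter: "transmitter net c s = i"
    unfolding transmitter_def arg_max_on_def arg_max_def is_arg_max_def using i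
    by (intro some_equality) (auto, metis less_asym)
  have "charge net (s k) (harvest2 net c i k) = max_level net" if "k \<noteq> i" for k
  proof (rule charge_full)
    have "threshold\<^sup>2 \<le> (cmod (c (SS i k)))\<^sup>2"
      using c[of "SS i k"] that by (intro threshold_le_cmod) (auto simp: favourable_def)
    \<comment> \<open>The beacon term is bounded below by zero; the source signal alone reaches the
      capacity.\<close>
    then have "efficiency net * slot_length net * (source_power net * threshold\<^sup>2) \<le> harvest2 net c i k"
      using valid unfolding harvest2_def
      by (intro mult_left_mono add_increasing2)
        (auto simp: valid_network_def source_power_def eps_delta_def intro!: mult_left_mono)
    with capacity_le_source show "capacity net \<le> harvest2 net c i k"
      by simp
  qed
  then show "next_state net c s = discharge i s"
    using i by (auto simp: next_state_def transmitter discharge_def fun_eq_iff)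
qed

section \<open>Reachability in the graph of transitions of positive probability\<close>

definition step :: "('k energy_state \<times> 'k energy_state) set" where
  "step = {(s, s'). s \<in> energy_states net \<and> s' \<in> energy_states net \<and> 0 < trans_prob M net h s s'}"

text \<open>It suffices to follow the deterministic dynamics on the favourable event, which has
  positive probability.\<close>

lemma stepI:
  assumes "s \<in> energy_states net"
    and "\<And>c. (\<And>l. l \<in> links \<Longrightarrow> c l \<in> favourable i l) \<Longrightarrow> next_state net c s = s'"
  shows "(s, s') \<in> step"
proof -
  let ?E = "{\<omega> \<in> space M. \<forall>l\<in>links. h 0 l \<omega> \<in> favourable i l}"
  have sub: "?E \<subseteq> {\<omega> \<in> space M. next_state net (channel \<omega>) s = s'}"
    using assms(2) by auto
  have "0 < prob ?E"
    by (rule prob_favourable_pos)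
  also have "\<dots> \<le> trans_prob M net h s s'"
    unfolding trans_prob_eq using sub pred_next_state
    by (intro finite_measure_mono) (simp_all add: pred_def)
  finally have pos: "0 < trans_prob M net h s s'" .
  have "?E \<noteq> {}"
    using prob_favourable_pos[of i] by (metis less_irrefl measure_empty)
  then have "s' \<in> energy_states net"
    using sub next_state_energy_states[OF assms(1)] by auto
  with pos assms(1) show ?thesis
    by (simp add: step_def)
qed

lemma step_full:
  assumes "s \<in> energy_states net" and "able net s = {}"
  shows "(s, \<lambda>_. max_level net) \<in> step"
  using assms(1) next_state_favourable_full[OF _ assms(2)] by (rule stepI)

lemma step_discharge:
  assumes "s \<in> energy_states net" and "i \<in> able net s"
  shows "(s, discharge i s) \<in> step"
  using assms(1) next_state_favourable_discharge[OF _ assms(2)] by (rule stepI)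

lemma tx_levels: "1 \<le> tx_levels net" "tx_levels net \<le> max_level net"
  using valid by (auto simp: valid_network_def)

lemma full_energy_states [simp]: "(\<lambda>_. max_level net) \<in> energy_states net"
  by (simp add: energy_states_def)

lemma discharge_energy_states [simp]:
  "s \<in> energy_states net \<Longrightarrow> discharge i s \<in> energy_states net"
  by (auto simp: energy_states_def discharge_def intro: le_trans[OF diff_le_self])

text \<open>A lone source keeps transmitting, each time losing at least one level, until it lacks
  energy; the next favourable slot fills it.\<close>

lemma reachable_single_source:
  assumes single: "\<And>k :: 'k. k = i" and "s \<in> energy_states net"
  shows "(s, \<lambda>_. max_level net) \<in> step\<^sup>*"
  using assms(2)
proof (induction "s i" arbitrary: s rule: less_induct)
  case less
  show ?case
  proof (cases "i \<in> able net s")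
    case True
    have "discharge i s i < s i"
      using True tx_levels(1) by (simp add: able_def discharge_def)
    then have "(discharge i s, \<lambda>_. max_level net) \<in> step\<^sup>*"
      using less.prems by (intro less.hyps) simp_all
    then show ?thesis
      using step_discharge[OF less.prems True] by (rule converse_rtrancl_into_rtrancl[rotated])
  next
    case False
    have "k \<notin> able net s" for k
      using False single[of k] by simp
    then have "able net s = {}"
      by blast
    then show ?thesis
      using step_full less.prems by blast
  qed
qed

text \<open>While \<open>j\<close> transmits, \<open>i\<close> is refilled, and \<open>j\<close>
  itself was full: all trace of \<open>s\<close> is lost.\<close>

lemma discharge_discharge: "j \<noteq> i \<Longrightarrow> discharge j (discharge i s) = discharge j (\<lambda>_. max_level net)"
  by (simp add: discharge_def fun_eq_iff)

lemma step_discharge_discharge: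
  assumes "j \<noteq> i" and "s \<in> energy_states net"
  shows "(discharge i s, discharge j (\<lambda>_. max_level net)) \<in> step"
proof -
  have "j \<in> able net (discharge i s)"
    using assms tx_levels(2) by (simp add: able_def discharge_def)
  then show ?thesis
    using step_discharge assms by (metis discharge_discharge discharge_energy_states)
qed

text \<open>If some source \<open>k\<close> different from \<open>i\<close> can transmit, discharge
  \<open>k\<close>, then \<open>i\<close>. If only \<open>i\<close> is at hand, discharge
  \<open>i\<close>, \<open>j\<close> and \<open>i\<close> again, since the first discharge of
  \<open>i\<close> still depends on \<open>s\<close>. If no source can transmit, fill all storages
  first.\<close>

lemma reachable_two_sources:
  assumes "j \<noteq> i" and s: "s \<in> energy_states net"
  shows "(s, discharge i (\<lambda>_. max_level net)) \<in> step\<^sup>*"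
proof -
  let ?full = "\<lambda>_ :: 'k. max_level net"
  have "(s, discharge i ?full) \<in> step\<^sup>*" if s: "s \<in> energy_states net" and k: "k \<in> able net s" for s k
  proof (cases "k = i")
    case True
    have "(s, discharge i s) \<in> step"
      using step_discharge s k True by simp
    moreover have "(discharge i s, discharge j ?full) \<in> step"
      "(discharge j ?full, discharge i ?full) \<in> step"
      using assms(1) s by (simp_all add: step_discharge_discharge)
    ultimately show ?thesis
      by (meson converse_rtrancl_into_rtrancl r_into_rtrancl)
  next
    case False
    then show ?thesis
      using step_discharge[OF s k] step_discharge_discharge[OF not_sym[OF False] s]
      by (meson converse_rtrancl_into_rtrancl r_into_rtrancl)
  qed
  note able = this
  show ?thesis
  proof (cases "able net s = {}")
    case True
    have "(?full, discharge i ?full) \<in> step\<^sup>*"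
      using tx_levels(2) by (intro able[of _ i]) (simp_all add: able_def)
    with step_full[OF s True] show ?thesis
      by (rule converse_rtrancl_into_rtrancl)
  next
    case False
    then show ?thesis
      using able[OF s] by blast
  qed
qed

lemma reachable_state:
  obtains z where "z \<in> energy_states net" "\<And>s. s \<in> energy_states net \<Longrightarrow> (s, z) \<in> step\<^sup>*"
proof (cases "\<exists>i j :: 'k. j \<noteq> i")
  case True
  then show ?thesis
    using that reachable_two_sources by (metis discharge_energy_states full_energy_states)
next
  case False
  then show ?thesis
    using that reachable_single_source by (metis full_energy_states)
qed

text \<open>Carries the common reachable state and the paths to it over to the index type, through
  the inverse of the enumeration \<open>st\<close>.\<close>

lemma rooted_transition_matrix:
  fixes st :: "'n::finite \<Rightarrow> 'k energy_state"
  assumes st: "bij_betw st UNIV (energy_states net)"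
  obtains root where "rooted_stochastic (\<lambda>i j. trans_prob M net h (st i) (st j)) root"
proof -
  obtain z where z: "z \<in> energy_states net" "\<And>s. s \<in> energy_states net \<Longrightarrow> (s, z) \<in> step\<^sup>*"
    by (rule reachable_state) blast
  have inv: "st (inv st s) = s" if "s \<in> energy_states net" for s
    using st that by (metis bij_betw_def f_inv_into_f)
  have mem: "st i \<in> energy_states net" for i
    using st by (auto simp: bij_betw_def)
  have "inj st"
    using st by (simp add: bij_betw_def)
  have path: "(inv st s, inv st s') \<in> {(i, j). 0 < trans_prob M net h (st i) (st j)}\<^sup>*"
    if "(s, s') \<in> step\<^sup>*" for s s'
    using that
  proof (induction rule: rtrancl_induct)
    case (step t u)
    then have "(inv st t, inv st u) \<in> {(i, j). 0 < trans_prob M net h (st i) (st j)}"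
      by (simp add: step_def inv)
    with step.IH show ?case
      by (rule rtrancl_into_rtrancl)
  qed simp
  show thesis
  proof (rule that[of "inv st z"], unfold_locales)
    fix i j
    show "0 \<le> trans_prob M net h (st i) (st j)"
      by (simp add: trans_prob_def)
    show "(\<Sum>j\<in>UNIV. trans_prob M net h (st i) (st j)) = 1"
      using sum.reindex_bij_betw[OF st, of "trans_prob M net h (st i)"] sum_trans_prob[OF mem] by simp
    have "(inv st (st i), inv st z) \<in> {(i, j). 0 < trans_prob M net h (st i) (st j)}\<^sup>*"
      using z(2)[OF mem] by (rule path)
    then show "(i, inv st z) \<in> {(i, j). 0 < trans_prob M net h (st i) (st j)}\<^sup>*"
      using \<open>inj st\<close> by simp
  qed
qed

subsection \<open>Stationary distributions\<close>

text \<open>A distribution supported on the energy states has total one over the indices, so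
  stationarity amounts to being the normalized invariant vector, which the linear system
  determines.\<close>

lemma stationary_distribution_iff:
  fixes st :: "'n::finite \<Rightarrow> 'k energy_state" and stat :: "real ^ 'n"
  assumes st: "bij_betw st UNIV (energy_states net)"
    and stat: "stat =
      matrix_inv (transpose (transition_matrix M net h st) - mat 1 + ones_matrix) *v ones_vector"
  shows "stationary_distribution M net h p \<longleftrightarrow>
    set_pmf p \<subseteq> energy_states net \<and> (\<forall>i. pmf p (st i) = stat $ i)"
proof -
  obtain root where rooted: "rooted_stochastic (\<lambda>i j. trans_prob M net h (st i) (st j)) root"
    using st by (rule rooted_transition_matrix)
  interpret A: rooted_stochastic "\<lambda>i j. trans_prob M net h (st i) (st j)" root
    by (rule rooted)
  have stat_iff: "x = stat \<longleftrightarrow> A.invariant (($) x) \<and> (\<Sum>i\<in>UNIV. x $ i) = 1" for x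
    unfolding stat transition_matrix_def by (rule A.matrix_inv_balance_eq_iff)
  have reindex: "(\<Sum>s\<in>energy_states net. f s) = (\<Sum>i\<in>UNIV. f (st i))" for f :: "_ \<Rightarrow> real"
    by (rule sum.reindex_bij_betw[OF st, symmetric])
  have ball: "(\<forall>s\<in>energy_states net. P s) \<longleftrightarrow> (\<forall>i. P (st i))" for P
    by (simp flip: bij_betw_imp_surj_on[OF st])
  have sum: "(\<Sum>i\<in>UNIV. pmf p (st i)) = 1" if "set_pmf p \<subseteq> energy_states net"
    using sum_pmf_eq_1[OF finite_energy_states that] by (simp only: reindex)
  have nth: "($) (\<chi> i. pmf p (st i)) = (\<lambda>i. pmf p (st i))"
    by (simp add: fun_eq_iff)
  have "stationary_distribution M net h p \<longleftrightarrow>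
      set_pmf p \<subseteq> energy_states net \<and> A.invariant (\<lambda>i. pmf p (st i))"
    by (simp only: stationary_distribution_def A.invariant_def reindex ball)
  also have "\<dots> \<longleftrightarrow> set_pmf p \<subseteq> energy_states net \<and> (\<chi> i. pmf p (st i)) = stat"
    unfolding stat_iff nth using sum by auto
  finally show ?thesis
    by (simp only: vec_eq_iff vec_lambda_beta)
qed

text \<open>The solution has total one, so \<open>invariant_nonneg\<close> makes it a probability
  vector; its image under \<open>st\<close> lives on the energy states.\<close>

lemma ex_pmf_stat:
  fixes st :: "'n::finite \<Rightarrow> 'k energy_state" and stat :: "real ^ 'n"
  assumes st: "bij_betw st UNIV (energy_states net)"
    and stat: "stat =
      matrix_inv (transpose (transition_matrix M net h st) - mat 1 + ones_matrix) *v ones_vector"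
  obtains p where "set_pmf p \<subseteq> energy_states net" "\<And>i. pmf p (st i) = stat $ i"
proof -
  obtain root where rooted: "rooted_stochastic (\<lambda>i j. trans_prob M net h (st i) (st j)) root"
    using st by (rule rooted_transition_matrix)
  interpret A: rooted_stochastic "\<lambda>i j. trans_prob M net h (st i) (st j)" root
    by (rule rooted)
  have inv: "A.invariant (($) stat)" and sum: "(\<Sum>i\<in>UNIV. stat $ i) = 1"
    using stat unfolding transition_matrix_def A.matrix_inv_balance_eq_iff by blast+
  have nonneg: "0 \<le> stat $ i" for i
    using inv by (rule A.invariant_nonneg) (simp add: sum)
  define q where "q = embed_pmf (($) stat)"
  have q: "pmf q i = stat $ i" for i
    unfolding q_def by (rule pmf_embed_pmf) (simp_all add: nonneg nn_integral_count_space_finite sum)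
  show thesis
  proof (rule that[of "map_pmf st q"])
    show "set_pmf (map_pmf st q) \<subseteq> energy_states net"
      using st by (auto simp: bij_betw_def)
    show "pmf (map_pmf st q) (st i) = stat $ i" for i
      using st q by (simp add: pmf_map_inj' bij_betw_def)
  qed
qed

lemma invertible_transition_matrix:
  fixes st :: "'n::finite \<Rightarrow> 'k energy_state"
  assumes st: "bij_betw st UNIV (energy_states net)"
  shows "invertible (transpose (transition_matrix M net h st) - mat 1 + ones_matrix)"
proof -
  obtain root where "rooted_stochastic (\<lambda>i j. trans_prob M net h (st i) (st j)) root"
    using st by (rule rooted_transition_matrix)
  then show ?thesis
    unfolding transition_matrix_def by (rule rooted_stochastic.invertible_balance_matrix)
qed

lemma ex1_stationary_distribution:
  fixes st :: "'n::finite \<Rightarrow> 'k energy_state"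
  assumes st: "bij_betw st UNIV (energy_states net)"
  shows "\<exists>!p. stationary_distribution M net h p"
proof -
  define stat where "stat =
    matrix_inv (transpose (transition_matrix M net h st) - mat 1 + ones_matrix) *v ones_vector"
  note iff = stationary_distribution_iff[OF st stat_def]
  obtain p where p: "set_pmf p \<subseteq> energy_states net" "\<And>i. pmf p (st i) = stat $ i"
    using ex_pmf_stat[OF st stat_def] by blast
  show ?thesis
  proof (rule ex1I)
    show "stationary_distribution M net h p"
      using p by (simp add: iff)
    fix q
    assume "stationary_distribution M net h q"
    then have q: "set_pmf q \<subseteq> energy_states net" "\<And>i. pmf q (st i) = stat $ i"
      by (auto simp: iff)
    show "q = p"
    proof (rule pmf_eqI)
      fix s
      show "pmf q s = pmf p s"
      proof (cases "s \<in> energy_states net")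
        case True
        then obtain i where "s = st i"
          using st by (auto simp: bij_betw_def)
        then show ?thesis
          by (simp add: p q)
      next
        case False
        then have "s \<notin> set_pmf p" "s \<notin> set_pmf q"
          using p(1) q(1) by auto
        then show ?thesis
          by (simp add: set_pmf_iff)
      qed
    qed
  qed
qed

lemma energy_outage_prob_eq:
  fixes st :: "'n::finite \<Rightarrow> 'k energy_state" and stat :: "real ^ 'n"
  assumes st: "bij_betw st UNIV (energy_states net)"
    and stat: "stat =
      matrix_inv (transpose (transition_matrix M net h st) - mat 1 + ones_matrix) *v ones_vector"
  shows "energy_outage_prob M net h = (\<Sum>n | st n \<in> Theta1 net. stat $ n)"
proof -
  define p where "p = (THE p. stationary_distribution M net h p)"
  have "stationary_distribution M net h p"
    unfolding p_def by (rule theI'[OF ex1_stationary_distribution[OF st]])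
  then have p: "set_pmf p \<subseteq> energy_states net" "\<And>i. pmf p (st i) = stat $ i"
    by (auto simp: stationary_distribution_iff[OF st stat])
  have "energy_outage_prob M net h = measure_pmf.prob p {s. network_outage net s}"
    by (simp add: energy_outage_prob_def p_def)
  \<comment> \<open>Only states in the support of \<open>p\<close> matter, and on energy states both
    conditions say that every level is below \<open>tx_levels net\<close>.\<close>
  also have "\<dots> = measure_pmf.prob p (Theta1 net)"
    using p(1) by (intro measure_prob_cong_0)
      (auto simp: Theta1_def able_def network_outage_def source_outage_def set_pmf_iff not_le)
  also have "\<dots> = (\<Sum>s\<in>Theta1 net. pmf p s)"
    using finite_energy_states by (intro measure_measure_pmf_finite) (simp add: Theta1_def)
  also have "\<dots> = (\<Sum>n | st n \<in> Theta1 net. pmf p (st n))"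
  proof (rule sum.reindex_bij_betw[symmetric])
    show "bij_betw st {n. st n \<in> Theta1 net} (Theta1 net)"
      using st by (auto simp: bij_betw_def Theta1_def inj_on_def)
  qed
  finally show ?thesis
    by (simp add: p(2))
qed

end

text \<open>The first two conjuncts give meaning to the third: uniqueness justifies the
  \<open>THE\<close> in \<open>energy_outage_prob\<close>, and invertibility makes
  \<open>matrix_inv\<close> a genuine inverse.\<close>

theorem theorem1:
  fixes M :: "'w measure"
    and net :: "('b::finite, 'k::finite) network"
    and h :: "nat \<Rightarrow> ('b, 'k) link \<Rightarrow> 'w \<Rightarrow> complex"
    and st :: "'n::finite \<Rightarrow> 'k energy_state"
    and A :: "real ^ 'n ^ 'n"
    and stat :: "real ^ 'n"
  assumes "prob_space M"
    and "CARD('b) \<ge> 2"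
    and "valid_network net"
    and "channel_model M net h"
    and "bij_betw st UNIV (energy_states net)"
    and "A = transition_matrix M net h st"
    and "stat = matrix_inv (transpose A - mat 1 + ones_matrix) *v ones_vector"
  shows "(\<exists>!p. stationary_distribution M net h p) \<and>
         invertible (transpose A - mat 1 + ones_matrix) \<and>
         energy_outage_prob M net h = (\<Sum>n | st n \<in> Theta1 net. stat $ n)"
proof -
  interpret powered_network M net h
    using assms(1,3,4) by (simp add: powered_network_def powered_network_axioms_def)
  show ?thesis
    using ex1_stationary_distribution[OF assms(5)] invertible_transition_matrix[OF assms(5)]
      energy_outage_prob_eq[OF assms(5) assms(7)[unfolded assms(6)]]
    unfolding assms(6) by blast
qed

end
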